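(* Let $n \ge 1$ and let $I = I(C_{2n+1}) \subseteq R = K[x_1,\ldots,x_{2n+1}]$ be the edge ideal of the odd cycle $C_{2n+1}$. For every integer $t\ge 1$, let $(D(t))$ be the ideal of $R$ generated by $$D(t) = \{x^{\underline{a}} \mid \deg(x^{\underline{a}}) < 2t \text{ and } w_{V'}(x^{\underline{a}}) \ge t \text{ for all minimal vertex covers } V' \text{ of } C_{2n+1}\}.$$ Then $I^{(t)} = I^t + (D(t))$.
   Context: $K$ is an algebraically closed field. $C_{2n+1}$ is the cycle graph with vertices $x_1,\ldots,x_{2n+1}$ and edges $\{x_j,x_{j+1}\}$ for $1\le j\le 2n$ and $\{x_{2n+1},x_1\}$; vertices are identified with the variables of the polynomial ring. The edge ideal $I(G)$ of a simple graph $G$ is the ideal generated by all products $x_ix_j$ with $\{x_i,x_j\}$ an edge of $G$. The $m$th symbolic power of an ideal $I$ of a polynomial ring $S$ is $I^{(m)} = S\cap\bigcap_{P\in \mathrm{Ass}(I)} I^m S_P$. A vertex cover of $G$ is a set $V'$ of vertices meeting every edge; it is minimal if it is minimal with respect to inclusion. For a set $V'$ of vertices and a monomial $x^{\underline{a}} = \prod_i x_i^{a_i}$, the vertex weight is $w_{V'}(x^{\underline{a}}) = \sum_{x_i\in V'} a_i$. *)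

theory Defs
  imports
    "HOL-Library.Poly_Mapping"
    "HOL-Computational_Algebra.Fraction_Field"
    "HOL-Computational_Algebra.Polynomial"
    "HOL-Algebra.Ideal_Product"
begin

section \<open>Polynomial rings and localizations\<close>

definition ring_on :: "'a::comm_ring_1 set \<Rightarrow> 'a ring" where
  "ring_on A = \<lparr>carrier = A, mult = (*), one = 1, zero = 0, add = (+)\<rparr>"

lemma cring_ring_on:
  assumes "1 \<in> A" "\<And>x y. x \<in> A \<Longrightarrow> y \<in> A \<Longrightarrow> x + y \<in> A"
    "\<And>x y. x \<in> A \<Longrightarrow> y \<in> A \<Longrightarrow> x * y \<in> A" "\<And>x. x \<in> A \<Longrightarrow> - x \<in> A"
  shows "cring (ring_on A)"
proof -
  have z: "0 \<in> A"
    using assms(2)[OF assms(1) assms(4)[OF assms(1)]] by simp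
  show ?thesis
  proof (rule cringI)
    show "abelian_group (ring_on A)"
    proof (rule abelian_groupI)
      fix x assume "x \<in> carrier (ring_on A)"
      then show "\<exists>y \<in> carrier (ring_on A). y \<oplus>\<^bsub>ring_on A\<^esub> x = \<zero>\<^bsub>ring_on A\<^esub>"
        using assms(4) by (intro bexI[of _ "- x"]) (simp_all add: ring_on_def)
    qed (simp_all add: ring_on_def assms z add.assoc add.commute)
    show "Group.comm_monoid (ring_on A)"
      by (rule Group.comm_monoidI) (simp_all add: ring_on_def assms ac_simps)
  qed (simp add: ring_on_def distrib_right)
qed

text \<open>Polynomials are finitely supported maps from exponent vectors to coefficients. The ring
  \<open>mpoly_ring V\<close> is the polynomial ring whose variables are the elements of \<open>V\<close>.\<close>

type_synonym ('v, 'k) mpoly = "('v \<Rightarrow>\<^sub>0 nat) \<Rightarrow>\<^sub>0 'k"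

definition mpoly_ring :: "'v set \<Rightarrow> ('v, 'k::comm_ring_1) mpoly ring" where
  "mpoly_ring V = ring_on {p. \<forall>a \<in> Poly_Mapping.keys p. Poly_Mapping.keys a \<subseteq> V}"

definition monomial :: "('v \<Rightarrow>\<^sub>0 nat) \<Rightarrow> ('v, 'k::comm_ring_1) mpoly" where
  "monomial a = Poly_Mapping.single a 1"

definition variable :: "'v \<Rightarrow> ('v, 'k::comm_ring_1) mpoly" where
  "variable x = monomial (Poly_Mapping.single x 1)"

lemma cring_mpoly_ring: "cring (mpoly_ring V :: ('v, 'k::comm_ring_1) mpoly ring)"
  unfolding mpoly_ring_def
proof (rule cring_ring_on, goal_cases)
  case (2 p q)
  then show ?case using Poly_Mapping.keys_add[of p q] by blast
next
  case (3 p q)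
  have "Poly_Mapping.keys (a + b) \<subseteq> V"
    if "a \<in> Poly_Mapping.keys p" "b \<in> Poly_Mapping.keys q" for a b
    using that 3 Poly_Mapping.keys_add[of a b] by blast
  then show ?case using keys_mult[of p q] by blast
qed auto

text \<open>For an integral domain \<open>R\<close> with the operations of its type and a prime ideal \<open>P\<close> of \<open>R\<close>,
  the localization of \<open>R\<close> at \<open>P\<close> is realized as a subring of the field of fractions.\<close>

definition localization :: "'a::idom ring \<Rightarrow> 'a set \<Rightarrow> 'a fract ring" where
  "localization R P = ring_on {Fraction_Field.Fract a s | a s. a \<in> carrier R \<and> s \<in> carrier R - P}"

lemma cring_localization:
  fixes A :: "'a::idom set"
  assumes "primeideal P (ring_on A)"
  shows "cring (localization (ring_on A) P)"
proof -
  interpret primeideal P "ring_on A" by fact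
  have sel: "carrier (ring_on A) = A" "mult (ring_on A) = (*)" "one (ring_on A) = 1"
    "zero (ring_on A) = 0" "add (ring_on A) = (+)"
    by (simp_all add: ring_on_def)
  have zP: "0 \<in> P" using additive_subgroup.zero_closed[OF is_additive_subgroup] by (simp add: sel)
  have oP: "1 \<notin> P" using one_imp_carrier I_notcarr by (auto simp: sel)
  have mP: "s * t \<in> A - P" if "s \<in> A - P" "t \<in> A - P" for s t
    using that I_prime[of s t] m_closed[of s t] by (auto simp: sel)
  have addA: "x + y \<in> A" and mulA: "x * y \<in> A" if "x \<in> A" "y \<in> A" for x y
    using that a_closed[of x y] m_closed[of x y] by (auto simp: sel)
  have negA: "- x \<in> A" if "x \<in> A" for x
  proof -
    have "x + \<ominus>\<^bsub>ring_on A\<^esub> x = 0" using r_neg[of x] that by (simp add: sel)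
    then have "- x = \<ominus>\<^bsub>ring_on A\<^esub> x" by (simp add: add_eq_0_iff)
    then show ?thesis using a_inv_closed[of x] that by (simp add: sel)
  qed
  have nz: "s \<noteq> 0" if "s \<in> A - P" for s using that zP by auto
  have oA: "1 \<in> A" using one_closed by (simp add: sel)
  show ?thesis
    unfolding localization_def sel
  proof (rule cring_ring_on, goal_cases)
    case 1
    then show ?case using oA oP by (auto simp: One_fract_def)
  next
    case (2 x y)
    then obtain a s b t where *: "x = Fraction_Field.Fract a s" "y = Fraction_Field.Fract b t"
      "a \<in> A" "b \<in> A" "s \<in> A - P" "t \<in> A - P" by blast
    then have "x + y = Fraction_Field.Fract (a * t + b * s) (s * t)" using nz by simp
    moreover have "a * t + b * s \<in> A" using * by (intro addA mulA) simp_all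
    ultimately show ?case using mP[OF *(5,6)] by blast
  next
    case (3 x y)
    then obtain a s b t where *: "x = Fraction_Field.Fract a s" "y = Fraction_Field.Fract b t"
      "a \<in> A" "b \<in> A" "s \<in> A - P" "t \<in> A - P" by blast
    then have "x * y = Fraction_Field.Fract (a * b) (s * t)" by simp
    then show ?case using mulA[OF *(3,4)] mP[OF *(5,6)] by blast
  next
    case (4 x)
    then obtain a s where *: "x = Fraction_Field.Fract a s" "a \<in> A" "s \<in> A - P" by blast
    then have "- x = Fraction_Field.Fract (- a) s" by simp
    then show ?case using *(3) negA[OF *(2)] by blast
  qed
qed


section \<open>Symbolic powers\<close>

definition associated_primes :: "'a ring \<Rightarrow> 'a set \<Rightarrow> 'a set set" where
  "associated_primes R I =
    {P. primeideal P R \<and> (\<exists>f \<in> carrier R. P = {r \<in> carrier R. r \<otimes>\<^bsub>R\<^esub> f \<in> I})}"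

text \<open>The embedding of \<open>R\<close> into its field of fractions is \<open>\<lambda>f. Fraction_Field.Fract f 1\<close>, so
  the ideal below is the extension of \<open>I\<^sup>m\<close> to the localization of \<open>R\<close> at \<open>P\<close>.\<close>

definition symbolic_power :: "'a::idom ring \<Rightarrow> 'a set \<Rightarrow> nat \<Rightarrow> 'a set" where
  "symbolic_power R I m =
    {f \<in> carrier R. \<forall>P \<in> associated_primes R I.
       Fraction_Field.Fract f 1 \<in>
         Idl\<^bsub>localization R P\<^esub> ((\<lambda>g. Fraction_Field.Fract g 1) ` (I [^]\<^bsub>ideals_set R\<^esub> m))}"


section \<open>Graphs, edge ideals and vertex covers\<close>

text \<open>A simple graph is given by its set of vertices and its set of edges, the latter being
  two-element sets of vertices.\<close>

definition cycle_edges :: "nat \<Rightarrow> nat set set" where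
  "cycle_edges N = {{j, j + 1} | j. 1 \<le> j \<and> j < N} \<union> {{N, 1}}"

definition edge_ideal :: "'v set \<Rightarrow> 'v set set \<Rightarrow> ('v, 'k::comm_ring_1) mpoly set" where
  "edge_ideal V E = Idl\<^bsub>mpoly_ring V\<^esub> {variable x * variable y | x y. {x, y} \<in> E}"

definition vertex_cover :: "'v set \<Rightarrow> 'v set set \<Rightarrow> 'v set \<Rightarrow> bool" where
  "vertex_cover V E C \<longleftrightarrow> C \<subseteq> V \<and> (\<forall>e \<in> E. e \<inter> C \<noteq> {})"

definition minimal_vertex_cover :: "'v set \<Rightarrow> 'v set set \<Rightarrow> 'v set \<Rightarrow> bool" where
  "minimal_vertex_cover V E C \<longleftrightarrow>
    vertex_cover V E C \<and> (\<forall>C'. vertex_cover V E C' \<and> C' \<subseteq> C \<longrightarrow> C' = C)"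

definition monomial_degree :: "('v \<Rightarrow>\<^sub>0 nat) \<Rightarrow> nat" where
  "monomial_degree a = (\<Sum>x \<in> Poly_Mapping.keys a. Poly_Mapping.lookup a x)"

definition vertex_weight :: "'v set \<Rightarrow> ('v \<Rightarrow>\<^sub>0 nat) \<Rightarrow> nat" where
  "vertex_weight C a = (\<Sum>x \<in> C. Poly_Mapping.lookup a x)"

definition D_set :: "'v set \<Rightarrow> 'v set set \<Rightarrow> nat \<Rightarrow> ('v, 'k::comm_ring_1) mpoly set" where
  "D_set V E t = {monomial a | a. Poly_Mapping.keys a \<subseteq> V \<and> monomial_degree a < 2 * t \<and>
    (\<forall>C. minimal_vertex_cover V E C \<longrightarrow> vertex_weight C a \<ge> t)}"

end

theory Submission
  imports Defs
begin

text \<open>The associated primes of a squarefree edge ideal are the primes \<open>P\<^sub>C\<close> generated by the minimal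
  vertex covers \<open>C\<close>. In the localization at \<open>P\<^sub>C\<close> the variables outside \<open>C\<close> become units, so the
  condition imposed there on \<open>f\<close> is that every monomial of \<open>f\<close> has \<open>C\<close>-weight at least \<open>t\<close>. Hence the
  symbolic power is spanned by the monomials of weight at least \<open>t\<close> on every minimal cover. Those of
  degree below \<open>2 t\<close> lie in \<open>D(t)\<close>; it remains to see that the others are divisible by a product of
  \<open>t\<close> edges. Using the edge \<open>{N, 1}\<close> of the odd cycle \<open>y\<close> times leaves a weighted path, where Koenig's
  theorem applies. It asks for weight at least \<open>t - y\<close> on path covers missing both ends and at least
  \<open>t + y\<close> on path covers containing both, and a suitable \<open>y\<close> exists because the weights of two such
  covers add up to at least \<open>2 t\<close>.\<close>

section \<open>Packing edges into exponent vectors\<close>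

text \<open>\<open>packs E t a\<close> says that the monomial with exponent \<open>a\<close> is divisible by a product of \<open>t\<close> edges.\<close>

inductive packs :: "'v set set \<Rightarrow> nat \<Rightarrow> ('v \<Rightarrow>\<^sub>0 nat) \<Rightarrow> bool" for E where
  zero: "packs E 0 a"
| step: "packs E t a \<Longrightarrow> {x, y} \<in> E \<Longrightarrow>
    packs E (Suc t) (a + Poly_Mapping.single x 1 + Poly_Mapping.single y 1)"

lemma packs_add_right: "packs E t a \<Longrightarrow> packs E t (a + b)"
proof (induction rule: packs.induct)
  case (step t a x y)
  then show ?case using packs.step[of E t "a + b" x y] by (simp add: ac_simps)
qed (rule packs.zero)

lemma packs_Suc_imp: "packs E (Suc t) a \<Longrightarrow> packs E t a"
  by (erule packs.cases) (auto simp: add.assoc intro: packs_add_right)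

lemma packs_antimono: "packs E t a \<Longrightarrow> s \<le> t \<Longrightarrow> packs E s a"
  by (induction t) (auto simp: le_Suc_eq dest: packs_Suc_imp)

lemma packs_add_edges:
  assumes "packs E t a" "{x, y} \<in> E"
  shows "packs E (k + t) (a + Poly_Mapping.single x k + Poly_Mapping.single y k)"
proof (induction k)
  case (Suc k)
  have "a + Poly_Mapping.single x (Suc k) + Poly_Mapping.single y (Suc k) =
    a + Poly_Mapping.single x k + Poly_Mapping.single y k
      + Poly_Mapping.single x 1 + Poly_Mapping.single y 1"
    by (rule poly_mapping_eqI) (simp add: lookup_add lookup_single when_def)
  then show ?case using packs.step[OF Suc assms(2)] by simp
qed (use assms in simp)

section \<open>Vertex weights and vertex covers\<close>

lemma vertex_weight_add: "vertex_weight C (a + b) = vertex_weight C a + vertex_weight C b"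
  by (simp add: vertex_weight_def lookup_add sum.distrib)

lemma vertex_weight_single:
  "finite C \<Longrightarrow> vertex_weight C (Poly_Mapping.single x k) = (if x \<in> C then k else 0)"
  by (simp add: vertex_weight_def lookup_single when_def)

lemma vertex_weight_mono: "finite D \<Longrightarrow> C \<subseteq> D \<Longrightarrow> vertex_weight C a \<le> vertex_weight D a"
  unfolding vertex_weight_def by (rule sum_mono2) auto

lemma vertex_weight_eq_0_iff:
  "finite C \<Longrightarrow> vertex_weight C a = 0 \<longleftrightarrow> Poly_Mapping.keys a \<inter> C = {}"
  by (auto simp: vertex_weight_def in_keys_iff)

lemma vertex_weight_insert:
  "finite C \<Longrightarrow> vertex_weight (insert x C) a =
    (if x \<in> C then vertex_weight C a else Poly_Mapping.lookup a x + vertex_weight C a)"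
  by (simp add: vertex_weight_def insert_absorb)

lemma vertex_weight_superset:
  "finite V \<Longrightarrow> Poly_Mapping.keys a \<subseteq> V \<Longrightarrow> vertex_weight V a = monomial_degree a"
  unfolding vertex_weight_def monomial_degree_def
  by (rule sum.mono_neutral_right) (auto simp: in_keys_iff)

text \<open>Shrinking a finite cover must stop. Since weights grow with the cover, lower bounds on
  minimal covers pass to all covers.\<close>

lemma minimal_vertex_cover_exists:
  assumes "finite V" "vertex_cover V E C"
  shows "\<exists>C' \<subseteq> C. minimal_vertex_cover V E C'"
proof -
  have "finite C" using assms finite_subset unfolding vertex_cover_def by blast
  then show ?thesis using assms(2)
  proof (induction C rule: finite_psubset_induct)
    case (psubset C)
    show ?case
    proof (cases "minimal_vertex_cover V E C")
      case False
      then obtain D where "vertex_cover V E D" "D \<subset> C"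
        using psubset.prems unfolding minimal_vertex_cover_def by blast
      then obtain C' where "C' \<subseteq> D" "minimal_vertex_cover V E C'" using psubset.IH by metis
      then show ?thesis using \<open>D \<subset> C\<close> by (intro exI[of _ C']) auto
    qed blast
  qed
qed

text \<open>Subtraction is truncated; for distinct \<open>x\<close>, \<open>y\<close> of exponent at
  least \<open>k\<close> this is division by the \<open>k\<close>th power of the edge.\<close>

definition split_edges :: "'v \<Rightarrow> 'v \<Rightarrow> nat \<Rightarrow> ('v \<Rightarrow>\<^sub>0 nat) \<Rightarrow> ('v \<Rightarrow>\<^sub>0 nat)" where
  "split_edges x y k a = a - Poly_Mapping.single x k - Poly_Mapping.single y k"

lemma split_edges_add:
  assumes "x \<noteq> y" "k \<le> Poly_Mapping.lookup a x" "k \<le> Poly_Mapping.lookup a y"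
  shows "split_edges x y k a + Poly_Mapping.single x k + Poly_Mapping.single y k = a"
  unfolding split_edges_def using assms
  by (intro poly_mapping_eqI) (auto simp: lookup_add lookup_minus lookup_single when_def)

text \<open>The start \<open>k\<close> varies so that an induction can remove the first vertex; for
  \<open>k = N\<close> there is no edge and the empty set is a cover.\<close>

definition path_cover :: "nat \<Rightarrow> nat \<Rightarrow> nat set \<Rightarrow> bool" where
  "path_cover k N C \<longleftrightarrow> C \<subseteq> {k..N} \<and> (\<forall>j. k \<le> j \<and> j < N \<longrightarrow> j \<in> C \<or> Suc j \<in> C)"

lemma path_cover_finite: "path_cover k N C \<Longrightarrow> finite C"
  unfolding path_cover_def using finite_subset by blast

text \<open>Koenig's theorem for weighted paths: the greedy choice at the first vertex is optimal.\<close>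

lemma packs_path:
  assumes "k \<le> N" "\<And>j. k \<le> j \<Longrightarrow> j < N \<Longrightarrow> {j, Suc j} \<in> E"
    and "\<And>C. path_cover k N C \<Longrightarrow> t \<le> vertex_weight C a"
  shows "packs E t a"
  using assms
proof (induction k arbitrary: t a rule: inc_induct)
  case base
  have "path_cover N N {}" by (auto simp: path_cover_def)
  from base(2)[OF this] show ?case by (simp add: vertex_weight_def packs.zero)
next
  case (step k)
  define c where "c = min (Poly_Mapping.lookup a k) (Poly_Mapping.lookup a (Suc k))"
  define b where "b = split_edges k (Suc k) c a"
  have ab: "b + Poly_Mapping.single k c + Poly_Mapping.single (Suc k) c = a"
    unfolding b_def by (rule split_edges_add) (auto simp: c_def)
  have "packs E (t - c) b"
  proof (rule step.IH)
    fix C assume C: "path_cover (Suc k) N C"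
    note fin = path_cover_finite[OF C]
    have k: "k \<notin> C" using C by (auto simp: path_cover_def)
    have cov1: "path_cover k N (insert k C)"
      using C step.hyps unfolding path_cover_def
      by (auto, metis Suc_leI le_neq_implies_less)
    have cov2: "path_cover k N C" if "Suc k \<in> C"
      using C that unfolding path_cover_def
      by (auto, metis Suc_leI le_neq_implies_less)
    have cov3: "path_cover k N (insert (Suc k) C)"
      using C step.hyps unfolding path_cover_def
      by (auto, metis Suc_leI le_neq_implies_less)
    have w: "vertex_weight C a = vertex_weight C b + (if Suc k \<in> C then c else 0)"
      using fin k unfolding ab[symmetric] by (simp add: vertex_weight_add vertex_weight_single)
    show "t - c \<le> vertex_weight C b"
    \<comment> \<open>If \<open>Suc k\<close> is in \<open>C\<close>, then \<open>C\<close> already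
      covers the longer path and its weight drops by exactly \<open>c\<close>. Otherwise either end
      of the first edge may be added to \<open>C\<close>; the cheaper one costs \<open>c\<close>,
      and the weight of \<open>C\<close> itself is unchanged.\<close>
    proof (cases "Suc k \<in> C")
      case True
      then show ?thesis using step.prems(2)[OF cov2] w by simp
    next
      case False
      then show ?thesis
        using step.prems(2)[OF cov1] step.prems(2)[OF cov3] w fin k
        by (auto simp: vertex_weight_insert c_def min_def)
    qed
  qed (use step.prems(1) in simp)
  \<comment> \<open>With truncated subtraction the sum is at least \<open>t\<close>, also when
    \<open>c\<close> exceeds \<open>t\<close>.\<close>
  then have "packs E (c + (t - c)) a"
    using packs_add_edges[of E "t - c" b k "Suc k" c] step.prems(1)[of k] step.hyps ab by simp
  then show ?case by (rule packs_antimono) simp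
qed

section \<open>Covers of the odd cycle\<close>

lemma vertex_cover_cycle_iff:
  assumes "1 \<le> N"
  shows "vertex_cover {1..N} (cycle_edges N) C \<longleftrightarrow> path_cover 1 N C \<and> (1 \<in> C \<or> N \<in> C)"
proof -
  have "(\<forall>e \<in> cycle_edges N. e \<inter> C \<noteq> {}) \<longleftrightarrow>
    (\<forall>j. 1 \<le> j \<and> j < N \<longrightarrow> j \<in> C \<or> Suc j \<in> C) \<and> (1 \<in> C \<or> N \<in> C)"
    unfolding cycle_edges_def by (simp add: ball_Un) blast
  then show ?thesis unfolding vertex_cover_def path_cover_def by simp
qed

text \<open>Every edge lies in \<open>{..k}\<close> or in \<open>{k..}\<close>, where the splice
  agrees with \<open>C\<close> or with \<open>D\<close> respectively.\<close>

lemma path_cover_splice: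
  assumes "path_cover 1 N C" "path_cover 1 N D" "k \<in> C" "k \<in> D"
  shows "path_cover 1 N (C \<inter> {..k} \<union> D \<inter> {k..})"
proof -
  have "j \<in> C \<inter> {..k} \<union> D \<inter> {k..} \<or> Suc j \<in> C \<inter> {..k} \<union> D \<inter> {k..}"
    if "1 \<le> j" "j < N" for j
  proof (cases "j < k")
    case True
    then show ?thesis using assms(1) that by (auto simp: path_cover_def)
  next
    case False
    then show ?thesis using assms(2) that by (auto simp: path_cover_def)
  qed
  then show ?thesis using assms(1,2) by (auto simp: path_cover_def)
qed

text \<open>The two splices together use each vertex as often as \<open>C\<close> and
  \<open>D\<close> do, the common vertex \<open>k\<close> twice on either side.\<close>

lemma vertex_weight_splice:
  assumes "finite C" "finite D" "k \<in> C" "k \<in> D"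
  shows "vertex_weight (C \<inter> {..k} \<union> D \<inter> {k..}) a + vertex_weight (D \<inter> {..k} \<union> C \<inter> {k..}) a
    = vertex_weight C a + vertex_weight D (a :: nat \<Rightarrow>\<^sub>0 nat)"
proof -
  let ?l = "Poly_Mapping.lookup a"
  \<comment> \<open>Passing from \<open>{k..}\<close> to \<open>{k<..}\<close> makes the two pieces
    disjoint, so that \<open>k\<close> is counted once.\<close>
  have split: "sum ?l (A \<inter> {..k} \<union> B \<inter> {k..}) = sum ?l (A \<inter> {..k}) + sum ?l (B \<inter> {k<..})"
    if "finite A" "finite B" "k \<in> A" "k \<in> B" for A B
  proof -
    have "A \<inter> {..k} \<union> B \<inter> {k..} = A \<inter> {..k} \<union> B \<inter> {k<..}"
      using that by (auto simp: le_less)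
    moreover have "A \<inter> {..k} \<inter> (B \<inter> {k<..}) = {}" by auto
    ultimately show ?thesis using that by (simp add: sum.union_disjoint)
  qed
  have whole: "A \<inter> {..k} \<union> A \<inter> {k..} = A" for A by auto
  show ?thesis
    unfolding vertex_weight_def
    using split[of C D] split[of D C] split[of C C] split[of D D] assms by (simp add: whole)
qed

text \<open>A vertex of one cover is absent from the other, so the edge to its successor forces the
  successor into the other cover.\<close>

lemma alternating_path_covers:
  assumes "path_cover 1 N C" "path_cover 1 N D" "C \<inter> D = {}" "1 \<in> D" "1 \<le> j" "j \<le> N"
  shows "if odd j then j \<in> D else j \<in> C"
  using assms(5,6)
proof (induction j rule: dec_induct)
  case (step j)
  then show ?case using assms unfolding path_cover_def by (auto split: if_splits)
qed (use assms in simp)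

text \<open>If two path covers share a vertex, exchanging their tails there gives two covers of the cycle;
  otherwise they alternate, and since the cycle is odd together they contain every vertex.\<close>

lemma path_covers_weight_sum:
  assumes "odd N"
    and cyc: "\<And>C. vertex_cover {1..N} (cycle_edges N) C \<Longrightarrow> t \<le> vertex_weight C a"
    and deg: "2 * t \<le> vertex_weight {1..N} a"
    and C: "path_cover 1 N C" "1 \<notin> C" "N \<notin> C"
    and D: "path_cover 1 N D" "1 \<in> D" "N \<in> D"
  shows "2 * t \<le> vertex_weight C a + vertex_weight D a"
proof -
  note fin = path_cover_finite[OF C(1)] path_cover_finite[OF D(1)]
  have N: "1 \<le> N" using assms(1) by (cases N) auto
  show ?thesis
  proof (cases "C \<inter> D = {}")
    case True
    have "{1..N} \<subseteq> C \<union> D"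
      using alternating_path_covers[OF C(1) D(1) True D(2)] by (fastforce split: if_splits)
    then have "vertex_weight {1..N} a \<le> vertex_weight (C \<union> D) a"
      using fin by (intro vertex_weight_mono) auto
    also have "\<dots> = vertex_weight C a + vertex_weight D a"
      unfolding vertex_weight_def using fin True by (intro sum.union_disjoint) auto
    finally show ?thesis using deg by simp
  next
    case False
    then obtain k where k: "k \<in> C" "k \<in> D" by blast
    then have "1 \<le> k" "k \<le> N" using C(1) by (auto simp: path_cover_def)
    then have "t \<le> vertex_weight (C \<inter> {..k} \<union> D \<inter> {k..}) a"
      "t \<le> vertex_weight (D \<inter> {..k} \<union> C \<inter> {k..}) a"
      using path_cover_splice[OF C(1) D(1) k] path_cover_splice[OF D(1) C(1) k(2,1)] D(2,3)
      by (auto intro!: cyc simp: vertex_cover_cycle_iff[OF N] simp del: One_nat_def)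
    then show ?thesis using vertex_weight_splice[OF fin k, of a] by simp
  qed
qed

text \<open>Split off \<open>y\<close> copies of \<open>{N, 1}\<close> and pack the rest on the
  path. With \<open>y\<close> least, covers missing both ends are heavy enough by definition of
  \<open>Q\<close>, and covers containing both ends by minimality together with
  \<open>path_covers_weight_sum\<close>.\<close>

lemma packs_odd_cycle:
  assumes N: "odd N" "3 \<le> N"
    and cyc: "\<And>C. vertex_cover {1..N} (cycle_edges N) C \<Longrightarrow> t \<le> vertex_weight C a"
    and deg: "2 * t \<le> vertex_weight {1..N} a"
  shows "packs (cycle_edges N) t a"
proof -
  \<comment> \<open>the number of times the edge \<open>{N, 1}\<close> has to be used before the rest can be done on the path\<close>
  define Q where "Q y \<longleftrightarrow>
    (\<forall>C. path_cover 1 N C \<and> 1 \<notin> C \<and> N \<notin> C \<longrightarrow> t \<le> vertex_weight C a + y)" for y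
  define y where "y = Least Q"
  have N1: "1 \<le> N" using N by simp
  \<comment> \<open>Adding one end to a path cover missing both gives a cover of the cycle, so the
    exponent of either end satisfies \<open>Q\<close>. Hence \<open>y\<close> is at most both
    exponents and \<open>y\<close> copies of the edge can be removed.\<close>
  have Q: "Q (Poly_Mapping.lookup a x)" if x: "x = 1 \<or> x = N" for x
    unfolding Q_def
  proof (intro allI impI, elim conjE)
    fix C assume C: "path_cover 1 N C" "1 \<notin> C" "N \<notin> C"
    then have "vertex_cover {1..N} (cycle_edges N) (insert x C)"
      using x N1 unfolding vertex_cover_cycle_iff[OF N1] by (auto simp: path_cover_def)
    from cyc[OF this] show "t \<le> vertex_weight C a + Poly_Mapping.lookup a x"
      using C x path_cover_finite[OF C(1)] by (auto simp: vertex_weight_insert)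
  qed
  have y: "Q y" "y \<le> Poly_Mapping.lookup a 1" "y \<le> Poly_Mapping.lookup a N"
    unfolding y_def using Q[of 1] Q[of N] by (auto intro: LeastI Least_le)
  have heavy: "t + y \<le> vertex_weight D a" if D: "path_cover 1 N D" "1 \<in> D" "N \<in> D" for D
  proof (cases "y = 0")
    case True
    then show ?thesis using cyc[of D] D by (simp add: vertex_cover_cycle_iff[OF N1] del: One_nat_def)
  next
    case False
    \<comment> \<open>The failure of \<open>Q\<close> at \<open>y - 1\<close> gives a cover
      \<open>C\<close> of weight at most \<open>t - y\<close>; as the two weights add up to at least
      \<open>2 * t\<close>, at least \<open>t + y\<close> remains for \<open>D\<close>.\<close>
    then have "\<not> Q (y - 1)" unfolding y_def by (intro not_less_Least) simp
    then obtain C where C: "path_cover 1 N C" "1 \<notin> C" "N \<notin> C" "vertex_weight C a + (y - 1) < t"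
      by (auto simp: Q_def not_le)
    with path_covers_weight_sum[OF N(1) cyc deg C(1-3) D] False show ?thesis by linarith
  qed
  define b where "b = split_edges N 1 y a"
  have ab: "b + Poly_Mapping.single N y + Poly_Mapping.single 1 y = a"
    unfolding b_def by (rule split_edges_add) (use y N in auto)
  have "packs (cycle_edges N) (t - y) b"
  proof (rule packs_path)
    fix C assume C: "path_cover 1 N C"
    have w: "vertex_weight C a =
      vertex_weight C b + (if N \<in> C then y else 0) + (if 1 \<in> C then y else 0)"
      using path_cover_finite[OF C] unfolding ab[symmetric]
      by (simp add: vertex_weight_add vertex_weight_single)
    \<comment> \<open>Removing the copies of \<open>{N, 1}\<close> costs \<open>y\<close> for each
      end in \<open>C\<close>. With no end \<open>Q\<close> applies, with one end \<open>C\<close>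
      covers the cycle, with both ends \<open>heavy\<close> applies.\<close>
    consider "1 \<notin> C" "N \<notin> C" | "(1 \<in> C) \<noteq> (N \<in> C)" | "1 \<in> C" "N \<in> C" by blast
    then show "t - y \<le> vertex_weight C b"
    proof cases
      case 1
      then show ?thesis using y(1) C w by (auto simp: Q_def)
    next
      case 2
      then have "t \<le> vertex_weight C a" using C by (intro cyc) (auto simp: vertex_cover_cycle_iff[OF N1] simp del: One_nat_def)
      then show ?thesis using w 2 by (auto split: if_splits)
    next
      case 3
      then show ?thesis using heavy[OF C] w by simp
    qed
  qed (use N1 in \<open>auto simp: cycle_edges_def\<close>)
  then have "packs (cycle_edges N) (y + (t - y)) a"
    using packs_add_edges[of _ "t - y" b N 1 y] ab by (simp add: cycle_edges_def)
  then show ?thesis by (rule packs_antimono) simp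
qed

section \<open>Ideals and localizations\<close>

lemma ring_on_simps [simp]:
  "carrier (ring_on A) = A" "mult (ring_on A) = (*)" "one (ring_on A) = 1"
  "zero (ring_on A) = 0" "add (ring_on A) = (+)"
  by (simp_all add: ring_on_def)

text \<open>Negation is multiplication by -1, so closure under sums and multiples yields an additive
  subgroup.\<close>

lemma ideal_ring_onI:
  assumes "cring (ring_on A)" "J \<subseteq> A" "0 \<in> J"
    and add: "\<And>x y. x \<in> J \<Longrightarrow> y \<in> J \<Longrightarrow> x + y \<in> J"
    and mult: "\<And>r x. r \<in> A \<Longrightarrow> x \<in> J \<Longrightarrow> r * x \<in> J"
  shows "ideal J (ring_on A)"
proof -
  interpret cring "ring_on A" by fact
  show ?thesis
  proof (rule idealI)
    show "subgroup J (add_monoid (ring_on A))"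
    proof (rule subgroup.intro)
      fix x assume x: "x \<in> J"
      then have "\<ominus>\<^bsub>ring_on A\<^esub> x = (\<ominus>\<^bsub>ring_on A\<^esub> \<one>\<^bsub>ring_on A\<^esub>) * x"
        using l_minus[of 1 x] assms(2) one_closed by auto
      then show "inv\<^bsub>add_monoid (ring_on A)\<^esub> x \<in> J"
        using mult[OF _ x] a_inv_closed[OF one_closed] by (simp add: a_inv_def)
    qed (use assms in auto)
  next
    fix a x assume "a \<in> J" "x \<in> carrier (ring_on A)"
    then show "x \<otimes>\<^bsub>ring_on A\<^esub> a \<in> J" "a \<otimes>\<^bsub>ring_on A\<^esub> x \<in> J"
      using mult[of x a] by (simp_all add: mult.commute)
  qed (rule ring_axioms)
qed

lemma ideal_ring_onD:
  assumes "ideal J (ring_on A)"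
  shows "0 \<in> J" "x \<in> J \<Longrightarrow> y \<in> J \<Longrightarrow> x + y \<in> J" "r \<in> A \<Longrightarrow> x \<in> J \<Longrightarrow> r * x \<in> J"
    "x \<in> J \<Longrightarrow> x \<in> A"
proof -
  interpret ideal J "ring_on A" by fact
  show "0 \<in> J" using additive_subgroup.zero_closed[OF is_additive_subgroup] by simp
  show "x \<in> J \<Longrightarrow> y \<in> J \<Longrightarrow> x + y \<in> J" using additive_subgroup.a_closed[OF is_additive_subgroup, of x y] by simp
  show "r \<in> A \<Longrightarrow> x \<in> J \<Longrightarrow> r * x \<in> J" using I_l_closed[of x r] by simp
  show "x \<in> J \<Longrightarrow> x \<in> A" using Icarr[of x] by simp
qed

lemma cring_ring_onD:
  assumes "cring (ring_on A)"
  shows "0 \<in> A" "1 \<in> A" "x \<in> A \<Longrightarrow> y \<in> A \<Longrightarrow> x + y \<in> A" "x \<in> A \<Longrightarrow> y \<in> A \<Longrightarrow> x * y \<in> A"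
proof -
  interpret cring "ring_on A" by fact
  show "0 \<in> A" using zero_closed by simp
  show "1 \<in> A" using one_closed by simp
  show "x \<in> A \<Longrightarrow> y \<in> A \<Longrightarrow> x + y \<in> A" using a_closed[of x y] by simp
  show "x \<in> A \<Longrightarrow> y \<in> A \<Longrightarrow> x * y \<in> A" using m_closed[of x y] by simp
qed

lemma primeideal_ring_onD:
  assumes "primeideal P (ring_on A)"
  shows "1 \<in> A - P" "s \<in> A - P \<Longrightarrow> t \<in> A - P \<Longrightarrow> s * t \<in> A - P"
proof -
  interpret primeideal P "ring_on A" by fact
  show "1 \<in> A - P" using one_closed one_imp_carrier I_notcarr by auto
  show "s \<in> A - P \<Longrightarrow> t \<in> A - P \<Longrightarrow> s * t \<in> A - P"
    using I_prime[of s t] m_closed[of s t] by auto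
qed

lemma ideal_pow_is_ideal:
  assumes "cring R" "ideal I R"
  shows "ideal (I [^]\<^bsub>ideals_set R\<^esub> (m :: nat)) R"
proof -
  interpret cring R by fact
  interpret M: Group.comm_monoid "ideals_set R" by (rule ideals_set_is_comm_monoid)
  show ?thesis
    using M.nat_pow_closed[of I m] assms(2) by (simp add: ideals_set_def)
qed

text \<open>Multipliers \<open>s\<close> and \<open>t\<close> of two elements have the common
  multiple \<open>s * t\<close>, again outside \<open>P\<close>. The set is the contraction of the
  extension of \<open>J\<close> to the localization.\<close>

lemma ideal_saturation:
  fixes A :: "'a::comm_ring_1 set"
  assumes P: "primeideal P (ring_on A)" and J: "ideal J (ring_on A)"
  shows "ideal {f \<in> A. \<exists>s \<in> A - P. s * f \<in> J} (ring_on A)"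
proof -
  interpret primeideal P "ring_on A" by fact
  note A = cring_ring_onD[OF is_cring]
  note JD = ideal_ring_onD[OF J]
  note PD = primeideal_ring_onD[OF P]
  show ?thesis
  proof (rule ideal_ring_onI, rule is_cring)
    fix f g assume "f \<in> {f \<in> A. \<exists>s \<in> A - P. s * f \<in> J}" "g \<in> {f \<in> A. \<exists>s \<in> A - P. s * f \<in> J}"
    then obtain s t where st: "f \<in> A" "g \<in> A" "s \<in> A - P" "t \<in> A - P" "s * f \<in> J" "t * g \<in> J"
      by blast
    have "s * t * (f + g) = t * (s * f) + s * (t * g)" by (simp add: algebra_simps)
    also have "\<dots> \<in> J" 
      using st JD(2)[OF JD(3)[of t "s * f"] JD(3)[of s "t * g"]] by blast
    finally show "f + g \<in> {f \<in> A. \<exists>s \<in> A - P. s * f \<in> J}" 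
      using st A(3) PD(2)[OF st(3,4)] by blast
  next
    fix r f assume r: "r \<in> A" and "f \<in> {f \<in> A. \<exists>s \<in> A - P. s * f \<in> J}"
    then obtain s where s: "f \<in> A" "s \<in> A - P" "s * f \<in> J" by blast
    have "s * (r * f) = r * (s * f)" by (simp add: algebra_simps)
    also have "\<dots> \<in> J" using JD(3)[OF r s(3)] .
    finally show "r * f \<in> {f \<in> A. \<exists>s \<in> A - P. s * f \<in> J}" 
      using A(4)[OF r s(1)] s(2) by blast
  qed (use A JD PD in auto)
qed

text \<open>The fractions with numerator in \<open>J\<close> and denominator outside
  \<open>P\<close> form an ideal containing the image of \<open>J\<close>, hence its extension.
  Conversely, \<open>s * f\<close> can be divided by the unit \<open>s\<close>.\<close>

lemma Fract_in_extension_iff: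
  fixes A :: "'a::idom set"
  assumes P: "primeideal P (ring_on A)" and J: "ideal J (ring_on A)" and f: "f \<in> A"
  shows "Fraction_Field.Fract f 1 \<in>
      Idl\<^bsub>localization (ring_on A) P\<^esub> ((\<lambda>g. Fraction_Field.Fract g 1) ` J)
    \<longleftrightarrow> (\<exists>s \<in> A - P. s * f \<in> J)"
proof -
  interpret P: primeideal P "ring_on A" by fact
  note A = cring_ring_onD[OF P.is_cring]
  note JD = ideal_ring_onD[OF J]
  note PD = primeideal_ring_onD[OF P]
  define L where "L = {Fraction_Field.Fract a s | a s. a \<in> A \<and> s \<in> A - P}"
  have L: "localization (ring_on A) P = ring_on L" by (simp add: localization_def L_def)
  have cL: "cring (ring_on L)" using cring_localization[OF P] by (simp add: L)
  interpret L: cring "ring_on L" by (rule cL)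
  have nz: "s \<noteq> 0" if "s \<in> A - P" for s
    using that ideal_ring_onD(1)[OF P.is_ideal] by auto
  let ?J = "(\<lambda>g. Fraction_Field.Fract g 1) ` J"
  let ?K = "{Fraction_Field.Fract g s | g s. g \<in> J \<and> s \<in> A - P}"
  have JL: "?J \<subseteq> L" using JD(4) PD(1) unfolding L_def by blast
  have "ideal ?K (ring_on L)"
  proof (rule ideal_ring_onI, rule cL)
    show "?K \<subseteq> L" using JD(4) unfolding L_def by blast
    show "0 \<in> ?K" using JD(1) PD(1) by (auto simp: Zero_fract_def)
    fix x y assume "x \<in> ?K" "y \<in> ?K"
    then obtain g s h t where *: "x = Fraction_Field.Fract g s" "y = Fraction_Field.Fract h t"
      "g \<in> J" "h \<in> J" "s \<in> A - P" "t \<in> A - P" by blast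
    then have "x + y = Fraction_Field.Fract (t * g + s * h) (s * t)"
      using nz by (simp add: mult.commute)
    moreover have "t * g + s * h \<in> J" using * JD by blast
    ultimately show "x + y \<in> ?K" using PD(2)[OF *(5,6)] by blast
  next
    fix r x assume "r \<in> L" "x \<in> ?K"
    then obtain g s h t where *: "r = Fraction_Field.Fract g s" "x = Fraction_Field.Fract h t"
      "g \<in> A" "h \<in> J" "s \<in> A - P" "t \<in> A - P" unfolding L_def by blast
    then have "r * x = Fraction_Field.Fract (g * h) (s * t)" by simp
    then show "r * x \<in> ?K" using JD(3)[OF *(3,4)] PD(2)[OF *(5,6)] by blast
  qed
  moreover have "?J \<subseteq> ?K" using PD(1) by blast
  ultimately have sub: "Idl\<^bsub>ring_on L\<^esub> ?J \<subseteq> ?K" by (rule L.genideal_minimal)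
  show ?thesis unfolding L
  proof
    assume "Fraction_Field.Fract f 1 \<in> Idl\<^bsub>ring_on L\<^esub> ?J"
    then obtain g s where *: "Fraction_Field.Fract f 1 = Fraction_Field.Fract g s" "g \<in> J" "s \<in> A - P"
      using sub by blast
    then have "s * f = g" using nz by (simp add: eq_fract mult.commute)
    then show "\<exists>s \<in> A - P. s * f \<in> J" using * by blast
  next
    assume "\<exists>s \<in> A - P. s * f \<in> J"
    then obtain s where s: "s \<in> A - P" "s * f \<in> J" by blast
    have K: "ideal (Idl\<^bsub>ring_on L\<^esub> ?J) (ring_on L)" using JL by (intro L.genideal_ideal) simp
    have "Fraction_Field.Fract (s * f) 1 \<in> Idl\<^bsub>ring_on L\<^esub> ?J"
      using s L.genideal_self[of ?J] JL by auto
    moreover have "Fraction_Field.Fract 1 s \<in> L" using s A by (auto simp: L_def)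
    ultimately have "Fraction_Field.Fract 1 s * Fraction_Field.Fract (s * f) 1 \<in> Idl\<^bsub>ring_on L\<^esub> ?J"
      using ideal_ring_onD(3)[OF K] by blast
    also have "Fraction_Field.Fract 1 s * Fraction_Field.Fract (s * f) 1 = Fraction_Field.Fract f 1"
      using nz[OF s(1)] by (simp add: eq_fract)
    finally show "Fraction_Field.Fract f 1 \<in> Idl\<^bsub>ring_on L\<^esub> ?J" .
  qed
qed

lemma symbolic_power_iff:
  fixes A :: "'a::idom set"
  assumes "cring (ring_on A)" "ideal I (ring_on A)"
  shows "f \<in> symbolic_power (ring_on A) I m \<longleftrightarrow> f \<in> A \<and>
    (\<forall>P \<in> associated_primes (ring_on A) I. \<exists>s \<in> A - P. s * f \<in> I [^]\<^bsub>ideals_set (ring_on A)\<^esub> m)"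
proof -
  have "Fraction_Field.Fract f 1 \<in> Idl\<^bsub>localization (ring_on A) P\<^esub>
      ((\<lambda>g. Fraction_Field.Fract g 1) ` (I [^]\<^bsub>ideals_set (ring_on A)\<^esub> m))
    \<longleftrightarrow> (\<exists>s \<in> A - P. s * f \<in> I [^]\<^bsub>ideals_set (ring_on A)\<^esub> m)"
    if "f \<in> A" "P \<in> associated_primes (ring_on A) I" for P
    using that by (intro Fract_in_extension_iff ideal_pow_is_ideal assms)
      (auto simp: associated_primes_def)
  then show ?thesis by (auto simp: symbolic_power_def)
qed

section \<open>Monomials and weights\<close>

definition polys :: "'v set \<Rightarrow> ('v, 'k::comm_ring_1) mpoly set" where
  "polys V = {p. \<forall>a \<in> Poly_Mapping.keys p. Poly_Mapping.keys a \<subseteq> V}"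

lemma mpoly_ring_eq: "mpoly_ring V = ring_on (polys V)"
  by (simp add: mpoly_ring_def polys_def)

lemma cring_polys: "cring (ring_on (polys V :: ('v, 'k::comm_ring_1) mpoly set))"
  using cring_mpoly_ring by (simp add: mpoly_ring_eq)

lemmas polys_closed = cring_ring_onD[OF cring_polys]

lemma keys_monomial [simp]:
  "Poly_Mapping.keys (monomial a :: ('v, 'k::comm_ring_1) mpoly) = {a}"
  by (simp add: monomial_def)

lemma monomial_in_polys_iff: "monomial a \<in> polys V \<longleftrightarrow> Poly_Mapping.keys a \<subseteq> V"
  by (simp add: polys_def)

lemma monomial_add: "monomial (a + b) = monomial a * monomial b"
  by (simp add: monomial_def mult_single)

lemma monomial_0: "monomial 0 = 1"
  by (simp add: monomial_def)

lemma keys_add_nat: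
  "Poly_Mapping.keys (a + b :: 'v \<Rightarrow>\<^sub>0 nat) = Poly_Mapping.keys a \<union> Poly_Mapping.keys b"
  by (auto simp: in_keys_iff lookup_add)

lemma variable_in_polys_iff: "variable x \<in> polys V \<longleftrightarrow> x \<in> V"
  by (simp add: variable_def monomial_in_polys_iff)

text \<open>A polynomial is a combination of its monomials with constant coefficients, and constants
  belong to \<open>polys V\<close>.\<close>

lemma poly_in_ideal:
  assumes J: "ideal J (ring_on (polys V))"
    and "\<And>a. a \<in> Poly_Mapping.keys p \<Longrightarrow> monomial a \<in> J"
  shows "p \<in> J"
  using assms(2)
proof (induction p rule: update_induct)
  case const
  then show ?case using ideal_ring_onD(1)[OF J] by simp
next
  case (update p a c)
  have eq: "Poly_Mapping.update a c p = p + Poly_Mapping.single 0 c * monomial a"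
    using update.hyps(1)
    by (intro poly_mapping_eqI)
      (auto simp: lookup_update lookup_add monomial_def mult_single lookup_single in_keys_iff when_def)
  have keys: "Poly_Mapping.keys (Poly_Mapping.update a c p) = insert a (Poly_Mapping.keys p)"
    using update.hyps by (simp add: keys_update)
  have "Poly_Mapping.single 0 c \<in> polys V" by (simp add: polys_def)
  then have "Poly_Mapping.single 0 c * monomial a \<in> J"
    using ideal_ring_onD(3)[OF J] update.prems by (simp add: keys)
  moreover have "p \<in> J" using update.IH update.prems by (simp add: keys)
  ultimately show ?case unfolding eq by (intro ideal_ring_onD(2)[OF J])
qed

text \<open>Filtering the coefficients by weight gives exact supports, which later show that a part
  is nonzero and bound the weights in the other.\<close>

lemma keys_homogeneous_parts:
  fixes p :: "'a \<Rightarrow>\<^sub>0 'b::monoid_add" and w :: "'a \<Rightarrow> nat"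
  obtains p0 p1 where "p = p0 + p1" "Poly_Mapping.keys p0 = {a \<in> Poly_Mapping.keys p. w a = d}"
    "Poly_Mapping.keys p1 = {a \<in> Poly_Mapping.keys p. w a \<noteq> d}"
proof
  let ?f = "\<lambda>Q. Poly_Mapping.mapp (\<lambda>a c. c when Q a) p"
  show "p = ?f (\<lambda>a. w a = d) + ?f (\<lambda>a. w a \<noteq> d)"
    by (rule poly_mapping_eqI) (simp add: lookup_add lookup_mapp when_def in_keys_iff)
qed (auto simp: in_keys_iff lookup_mapp when_def split: if_splits)

text \<open>The product of the components of lowest weight is nonzero, so lowest weights add up.\<close>

lemma weight_le_of_mult:
  fixes s f :: "('v::linorder \<Rightarrow>\<^sub>0 nat) \<Rightarrow>\<^sub>0 'k::idom" and w :: "('v \<Rightarrow>\<^sub>0 nat) \<Rightarrow> nat"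
  assumes w: "\<And>a b. w (a + b) = w a + w b"
    and s: "b \<in> Poly_Mapping.keys s" "w b = 0"
    and sf: "\<And>a. a \<in> Poly_Mapping.keys (s * f) \<Longrightarrow> t \<le> w a"
    and f: "a \<in> Poly_Mapping.keys f"
  shows "t \<le> w a"
proof -
  define d where "d = Min (w ` Poly_Mapping.keys f)"
  have d: "d \<le> w c" if "c \<in> Poly_Mapping.keys f" for c
    using that unfolding d_def by simp
  have "d \<in> w ` Poly_Mapping.keys f" unfolding d_def using f by (intro Min_in) auto
  then obtain c where c: "c \<in> Poly_Mapping.keys f" "w c = d" by blast
  obtain f0 f1 where f01: "f = f0 + f1" "Poly_Mapping.keys f0 = {a \<in> Poly_Mapping.keys f. w a = d}"
    "Poly_Mapping.keys f1 = {a \<in> Poly_Mapping.keys f. w a \<noteq> d}"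
    by (rule keys_homogeneous_parts)
  obtain s0 s1 where s01: "s = s0 + s1" "Poly_Mapping.keys s0 = {a \<in> Poly_Mapping.keys s. w a = 0}"
    "Poly_Mapping.keys s1 = {a \<in> Poly_Mapping.keys s. w a \<noteq> 0}"
    by (rule keys_homogeneous_parts)
  have "f0 \<noteq> 0" "s0 \<noteq> 0" using c s f01(2) s01(2) by auto
  \<comment> \<open>The order on the variables makes exponent vectors a linearly ordered monoid, so
    there are no zero divisors.\<close>
  then have "s0 * f0 \<noteq> 0" by simp
  then obtain k where k: "k \<in> Poly_Mapping.keys (s0 * f0)" by (metis all_not_in_conv keys_eq_empty)
  then have wk: "w k = d" using keys_mult[of s0 f0] f01(2) s01(2) by (auto simp: w)
  \<comment> \<open>All other contributions to \<open>s * f\<close> have weight above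
    \<open>d\<close>, so the term found at weight \<open>d\<close> cannot cancel.\<close>
  have "d < w k" if "k \<in> Poly_Mapping.keys (s0 * f1 + s1 * f)"
  proof -
    from that consider "k \<in> Poly_Mapping.keys (s0 * f1)" | "k \<in> Poly_Mapping.keys (s1 * f)"
      using Poly_Mapping.keys_add[of "s0 * f1" "s1 * f"] by blast
    then show ?thesis
    proof cases
      case 1
      then obtain x y where "k = x + y" "y \<in> Poly_Mapping.keys f1"
        using keys_mult[of s0 f1] by blast
      then show ?thesis using f01(3) d[of y] by (auto simp: w)
    next
      case 2
      then obtain x y where "k = x + y" "x \<in> Poly_Mapping.keys s1" "y \<in> Poly_Mapping.keys f"
        using keys_mult[of s1 f] by blast
      then show ?thesis using s01(3) d[of y] by (auto simp: w)
    qed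
  qed
  then have "k \<notin> Poly_Mapping.keys (s0 * f1 + s1 * f)" using wk by auto
  moreover have "s * f = s0 * f0 + (s0 * f1 + s1 * f)" by (simp add: f01(1) s01(1) algebra_simps)
  ultimately have "k \<in> Poly_Mapping.keys (s * f)" using k by (simp add: in_keys_iff lookup_add)
  then show ?thesis using sf[of k] wk d[OF f] by simp
qed

text \<open>For finite \<open>C\<close> inside \<open>V\<close> this is the \<open>d\<close>th power
  of the prime generated by the variables in \<open>C\<close>, given by a condition on single
  monomials.\<close>

definition weight_ideal :: "'v set \<Rightarrow> 'v set \<Rightarrow> nat \<Rightarrow> ('v, 'k::comm_ring_1) mpoly set" where
  "weight_ideal V C d = {p \<in> polys V. \<forall>a \<in> Poly_Mapping.keys p. d \<le> vertex_weight C a}"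

lemma weight_ideal_mult:
  assumes "p \<in> weight_ideal V C d" "q \<in> weight_ideal V C e"
  shows "p * q \<in> weight_ideal V C (d + e)"
  using assms polys_closed(4)[of p V q] keys_mult[of p q]
  by (fastforce simp: weight_ideal_def vertex_weight_add intro: add_mono)

lemma weight_ideal_0: "weight_ideal V C 0 = polys V"
  by (simp add: weight_ideal_def)

lemma weight_ideal_add:
  assumes "p \<in> weight_ideal V C d" "q \<in> weight_ideal V C d"
  shows "p + q \<in> weight_ideal V C d"
  using assms polys_closed(3)[of p V q] Poly_Mapping.keys_add[of p q]
  by (auto simp: weight_ideal_def)

lemma ideal_weight_ideal: "ideal (weight_ideal V C d) (ring_on (polys V))"
proof (rule ideal_ring_onI[OF cring_polys])
  fix r p :: "('a, 'b) mpoly" assume "r \<in> polys V" "p \<in> weight_ideal V C d"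
  then show "r * p \<in> weight_ideal V C d"
    using weight_ideal_mult[of r V C 0 p d] by (simp add: weight_ideal_0)
qed (auto simp: weight_ideal_add, auto simp: weight_ideal_def polys_closed)

section \<open>Symbolic powers of edge ideals\<close>

locale simple_graph =
  fixes V :: "'v::linorder set" and E :: "'v set set"
  assumes finite_vertices: "finite V"
    and edges: "{x, y} \<in> E \<Longrightarrow> x \<in> V \<and> y \<in> V \<and> x \<noteq> y"
    and edges_pairs: "e \<in> E \<Longrightarrow> \<exists>x y. e = {x, y}"
begin

lemma edge_ideal_gens:
  "{variable x * variable y | x y. {x, y} \<in> E} \<subseteq> (polys V :: ('v, 'k::idom) mpoly set)"
  using edges by (auto intro!: polys_closed(4) simp: variable_in_polys_iff)

lemma ideal_edge_ideal: "ideal (edge_ideal V E :: ('v, 'k::idom) mpoly set) (ring_on (polys V))"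
  unfolding edge_ideal_def mpoly_ring_eq
  using edge_ideal_gens
  by (intro ring.genideal_ideal cring.axioms(1) cring_polys) simp

lemma edge_in_edge_ideal:
  "{x, y} \<in> E \<Longrightarrow> variable x * variable y \<in> (edge_ideal V E :: ('v, 'k::idom) mpoly set)"
  unfolding edge_ideal_def mpoly_ring_eq
  using ring.genideal_self[OF cring.axioms(1)[OF cring_polys], of _ V, simplified, OF edge_ideal_gens]
  by blast

lemma variables_mult: "variable x * variable y = monomial (Poly_Mapping.single x 1 + Poly_Mapping.single y 1)"
  by (simp add: variable_def monomial_add)

lemma monomial_in_edge_ideal:
  assumes "{x, y} \<in> E" "x \<in> Poly_Mapping.keys a" "y \<in> Poly_Mapping.keys a" "Poly_Mapping.keys a \<subseteq> V"
  shows "monomial a \<in> (edge_ideal V E :: ('v, 'k::idom) mpoly set)"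
proof -
  let ?b = "split_edges x y 1 a"
  have a: "?b + (Poly_Mapping.single x 1 + Poly_Mapping.single y 1) = a"
    using split_edges_add[of x y 1 a] edges[OF assms(1)] assms(2,3)
    by (simp add: in_keys_iff add.assoc)
  then have "Poly_Mapping.keys ?b \<subseteq> V"
    using assms(4) keys_add_nat[of ?b "Poly_Mapping.single x 1 + Poly_Mapping.single y 1"] by auto
  then have "monomial ?b * (variable x * variable y) \<in> (edge_ideal V E :: ('v, 'k) mpoly set)"
    by (intro ideal_ring_onD(3)[OF ideal_edge_ideal] edge_in_edge_ideal assms(1))
      (simp add: monomial_in_polys_iff)
  then show ?thesis unfolding variables_mult monomial_add[symmetric] a .
qed

lemma packs_imp_monomial_in_power:
  assumes "packs E t a" "Poly_Mapping.keys a \<subseteq> V"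
  shows "monomial a \<in> (edge_ideal V E :: ('v, 'k::idom) mpoly set) [^]\<^bsub>ideals_set (ring_on (polys V))\<^esub> t"
  using assms
proof (induction rule: packs.induct)
  case (zero a)
  then show ?case by (simp add: ideals_set_def nat_pow_def monomial_in_polys_iff)
next
  case (step t a x y)
  have "monomial a * (variable x * variable y) \<in>
    (edge_ideal V E :: ('v, 'k) mpoly set) [^]\<^bsub>ideals_set (ring_on (polys V))\<^esub> Suc t"
    using step.IH step.prems edge_in_edge_ideal[OF step.hyps(2), where 'k = 'k]
      ideal_prod.prod[of "monomial a" _ "variable x * variable y" _ "ring_on (polys V)"]
    by (simp add: ideals_set_def nat_pow_def keys_add_nat)
  then show ?case by (simp add: variables_mult monomial_add[symmetric] add.assoc)
qed

lemma finite_vertex_cover: "vertex_cover V E C \<Longrightarrow> finite C"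
  unfolding vertex_cover_def by (metis finite_subset finite_vertices)

lemma edge_ideal_subset_weight_ideal:
  assumes C: "vertex_cover V E C"
  shows "(edge_ideal V E :: ('v, 'k::idom) mpoly set) \<subseteq> weight_ideal V C 1"
proof -
  have "variable x * variable y \<in> (weight_ideal V C 1 :: ('v, 'k) mpoly set)" if "{x, y} \<in> E" for x y
  proof -
    have "x \<in> C \<or> y \<in> C" using C that by (auto simp: vertex_cover_def)
    then show ?thesis
      using edges[OF that] finite_vertex_cover[OF C]
      by (auto simp: variables_mult weight_ideal_def monomial_in_polys_iff keys_add_nat
          vertex_weight_add vertex_weight_single)
  qed
  then show ?thesis
    unfolding edge_ideal_def mpoly_ring_eq
    by (intro ring.genideal_minimal cring.axioms(1) cring_polys ideal_weight_ideal) auto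
qed

text \<open>Each further factor from the edge ideal adds at least 1 to the weight.\<close>

lemma edge_ideal_power_subset_weight_ideal:
  assumes C: "vertex_cover V E C"
  shows "(edge_ideal V E :: ('v, 'k::idom) mpoly set) [^]\<^bsub>ideals_set (ring_on (polys V))\<^esub> (t :: nat)
    \<subseteq> weight_ideal V C t"
proof (induction t)
  case 0
  then show ?case by (simp add: ideals_set_def nat_pow_def weight_ideal_0)
next
  case (Suc t)
  let ?I = "edge_ideal V E :: ('v, 'k) mpoly set"
  have "p \<in> weight_ideal V C (t + 1)"
    if "p \<in> ideal_prod (ring_on (polys V)) (?I [^]\<^bsub>ideals_set (ring_on (polys V))\<^esub> t) ?I" for p
    using that
  proof (induction rule: ideal_prod.induct)
    case (prod i j)
    then show ?case
      using Suc edge_ideal_subset_weight_ideal[OF C, where 'k = 'k]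
        weight_ideal_mult[of i V C t j 1] by auto
  qed (use weight_ideal_add in auto)
  then show ?case by (auto simp: ideals_set_def nat_pow_def)
qed

text \<open>Such an \<open>s\<close> has a monomial of weight 0, so \<open>weight_le_of_mult\<close>
  applies. The case \<open>t = 1\<close> gives primality; in general the powers of this prime are
  primary.\<close>

lemma weight_ideal_of_mult:
  fixes s f :: "('v, 'k::idom) mpoly"
  assumes "s \<notin> weight_ideal V C 1" "s \<in> polys V" "f \<in> polys V" "s * f \<in> weight_ideal V C t"
  shows "f \<in> weight_ideal V C t"
proof -
  obtain b where "b \<in> Poly_Mapping.keys s" "vertex_weight C b = 0"
    using assms(1,2) by (auto simp: weight_ideal_def)
  then show ?thesis
    using assms(3,4) weight_le_of_mult[of "vertex_weight C" b s f t]
    by (auto simp: weight_ideal_def vertex_weight_add)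
qed

section \<open>Minimal covers and associated primes\<close>

lemma minimal_vertex_cover_private_edge:
  assumes C: "minimal_vertex_cover V E C" and x: "x \<in> C"
  obtains y where "{x, y} \<in> E" "y \<in> V - C"
proof -
  have cov: "vertex_cover V E C" using C by (simp add: minimal_vertex_cover_def)
  \<comment> \<open>An edge missed by \<open>C - {x}\<close> meets \<open>C\<close> in
    \<open>x\<close> alone, and its other end is the \<open>y\<close> sought.\<close>
  have "\<not> vertex_cover V E (C - {x})"
  proof
    assume "vertex_cover V E (C - {x})"
    moreover have "C - {x} \<subseteq> C" by (rule Diff_subset)
    ultimately have "C - {x} = C" using C unfolding minimal_vertex_cover_def by metis
    then show False using x by (metis Diff_iff singletonI)
  qed
  moreover have "C - {x} \<subseteq> V" using cov by (auto simp: vertex_cover_def)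
  ultimately obtain e where e: "e \<in> E" "e \<inter> (C - {x}) = {}"
    unfolding vertex_cover_def by metis
  obtain u v where uv: "e = {u, v}" using edges_pairs[OF e(1)] by metis
  have E: "{u, v} \<in> E" using e(1) uv by simp
  note V = edges[OF E]
  have "u \<in> C \<or> v \<in> C" using cov E by (auto simp: vertex_cover_def)
  moreover have "u \<notin> C - {x}" "v \<notin> C - {x}" using e(2) uv by auto
  ultimately consider "u = x" "v \<notin> C" | "v = x" "u \<notin> C" using V by (metis Diff_iff singletonD)
  then show ?thesis
  proof cases
    case 1
    then show ?thesis using E V that[of v] by (metis DiffI)
  next
    case 2
    then show ?thesis using E V that[of u] by (metis DiffI insert_commute)
  qed
qed

text \<open>The prime of a minimal cover \<open>C\<close> is the annihilator, modulo the edge ideal, of the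
  product of the variables outside \<open>C\<close>.\<close>

lemma weight_ideal_associated_prime:
  assumes C: "minimal_vertex_cover V E C"
  shows "weight_ideal V C 1 \<in>
    associated_primes (ring_on (polys V)) (edge_ideal V E :: ('v, 'k::idom) mpoly set)"
proof -
  let ?P = "weight_ideal V C 1 :: ('v, 'k) mpoly set"
  let ?I = "edge_ideal V E :: ('v, 'k) mpoly set"
  have cov: "vertex_cover V E C" using C by (simp add: minimal_vertex_cover_def)
  note fin = finite_vertex_cover[OF cov]
  define u :: "'v \<Rightarrow>\<^sub>0 nat" where "u = (\<Sum>x \<in> V - C. Poly_Mapping.single x 1)"
  have "Poly_Mapping.lookup u x = (if x \<in> V - C then 1 else 0)" for x
    using finite_vertices by (simp add: u_def lookup_sum lookup_single when_def)
  then have keys_u: "Poly_Mapping.keys u = V - C" by (auto simp: in_keys_iff split: if_splits)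
  have wu: "vertex_weight C u = 0" using fin keys_u by (auto simp: vertex_weight_eq_0_iff)
  have u: "monomial u \<in> polys V" "monomial u \<notin> ?P"
    using keys_u wu by (auto simp: monomial_in_polys_iff weight_ideal_def)
  have "1 \<notin> ?P" by (simp add: weight_ideal_def vertex_weight_def)
  then have prime: "primeideal ?P (ring_on (polys V))"
    using weight_ideal_of_mult[where 'k = 'k and C = C and t = 1] polys_closed(2)[of V]
    by (intro primeidealI ideal_weight_ideal cring_polys) auto
  \<comment> \<open>Each monomial of \<open>r\<close> contains some \<open>x\<close> in
    \<open>C\<close>; a neighbour \<open>y\<close> of \<open>x\<close> outside \<open>C\<close>
    occurs in \<open>u\<close>, so an edge divides the term.\<close>
  have "r * monomial u \<in> ?I" if r: "r \<in> ?P" for r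
  proof (rule poly_in_ideal[OF ideal_edge_ideal])
    fix k assume k: "k \<in> Poly_Mapping.keys (r * monomial u)"
    then obtain a where a: "a \<in> Poly_Mapping.keys r" "k = a + u"
      using keys_mult[of r "monomial u"] by auto
    have "vertex_weight C a \<noteq> 0" using r a by (auto simp: weight_ideal_def)
    then obtain x where x: "x \<in> Poly_Mapping.keys a" "x \<in> C"
      using fin by (auto simp: vertex_weight_eq_0_iff)
    obtain y where y: "{x, y} \<in> E" "y \<in> V - C"
      using minimal_vertex_cover_private_edge[OF C x(2)] .
    show "monomial k \<in> ?I"
      using x y a r keys_u
      by (intro monomial_in_edge_ideal[OF y(1)]) (auto simp: keys_add_nat weight_ideal_def polys_def)
  qed
  moreover have "r \<in> ?P" if r: "r \<in> polys V" "r * monomial u \<in> ?I" for r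
    using weight_ideal_of_mult[OF u(2,1) r(1)] edge_ideal_subset_weight_ideal[OF cov, where 'k = 'k] r(2)
    by (auto simp: mult.commute)
  moreover have "?P \<subseteq> polys V" by (auto simp: weight_ideal_def)
  ultimately have "?P = {r \<in> polys V. r * monomial u \<in> ?I}" by blast
  then show ?thesis using prime u(1) by (auto simp: associated_primes_def)
qed

text \<open>\<open>P\<close> is the annihilator of some \<open>f\<close> modulo the edge ideal, and
  a monomial of \<open>f\<close> outside the edge ideal has a support without edges. The complement
  of that support contains a minimal cover \<open>C\<close>. The variables in \<open>P\<close> form
  a cover, as \<open>P\<close> is prime; it lies inside \<open>C\<close>, so it equals
  \<open>C\<close>.\<close>

lemma associated_prime_minimal_cover:
  assumes P: "P \<in> associated_primes (ring_on (polys V)) (edge_ideal V E :: ('v, 'k::idom) mpoly set)"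
  obtains C where "minimal_vertex_cover V E C" "\<And>x. x \<in> V - C \<Longrightarrow> variable x \<notin> P"
proof -
  let ?I = "edge_ideal V E :: ('v, 'k) mpoly set"
  obtain f where prime: "primeideal P (ring_on (polys V))" and f: "f \<in> polys V"
    and Pf: "P = {r \<in> polys V. r * f \<in> ?I}"
    using P by (auto simp: associated_primes_def)
  have "f \<notin> ?I" using primeideal_ring_onD(1)[OF prime] by (auto simp: Pf)
  then obtain b where b: "b \<in> Poly_Mapping.keys f" "monomial b \<notin> ?I"
    using poly_in_ideal[OF ideal_edge_ideal] by blast
  have bV: "Poly_Mapping.keys b \<subseteq> V" using f b(1) by (auto simp: polys_def)
  have "vertex_cover V E (V - Poly_Mapping.keys b)"
    unfolding vertex_cover_def
  proof safe
    fix e assume e: "e \<in> E" "e \<inter> (V - Poly_Mapping.keys b) = {}"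
    then obtain x y where xy: "e = {x, y}" using edges_pairs by blast
    then show False using monomial_in_edge_ideal[of x y b] b(2) bV e edges[of x y] by auto
  qed
  then obtain C where C: "minimal_vertex_cover V E C" "C \<subseteq> V - Poly_Mapping.keys b"
    using minimal_vertex_cover_exists[OF finite_vertices] by metis
  have cov: "vertex_cover V E C" using C by (simp add: minimal_vertex_cover_def)
  note fin = finite_vertex_cover[OF cov]
  have wb: "vertex_weight C b = 0" using C(2) fin by (auto simp: vertex_weight_eq_0_iff)
  have fC: "f \<notin> weight_ideal V C 1" using b(1) wb by (force simp: weight_ideal_def)
  define C' where "C' = {x \<in> V. variable x \<in> P}"
  have "vertex_cover V E C'"
    unfolding vertex_cover_def
  proof safe
    fix e assume e: "e \<in> E" "e \<inter> C' = {}"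
    then obtain x y where xy: "e = {x, y}" using edges_pairs by blast
    then have V: "x \<in> V" "y \<in> V" using e edges by auto
    have "f * (variable x * variable y) \<in> ?I"
      using ideal_ring_onD(3)[OF ideal_edge_ideal f] edge_in_edge_ideal e xy by blast
    then have "variable x * variable y \<in> P"
      using V by (auto simp: Pf mult.commute intro!: polys_closed simp: variable_in_polys_iff)
    then show False
      using primeideal_ring_onD(2)[OF prime, of "variable x" "variable y"] V e xy
      by (auto simp: C'_def variable_in_polys_iff)
  qed (auto simp: C'_def)
  \<comment> \<open>The product of \<open>f\<close> and \<open>variable x\<close> lies in the prime
    of \<open>C\<close> but \<open>f\<close> does not, so \<open>variable x\<close> does.\<close>
  moreover have "C' \<subseteq> C"
  proof
    fix x assume x: "x \<in> C'"
    then have "f * variable x \<in> weight_ideal V C 1"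
      using edge_ideal_subset_weight_ideal[OF cov, where 'k = 'k]
      by (auto simp: C'_def Pf mult.commute)
    then have "variable x \<in> (weight_ideal V C 1 :: ('v, 'k) mpoly set)"
      using weight_ideal_of_mult[OF fC f] x by (auto simp: C'_def variable_in_polys_iff)
    then show "x \<in> C"
      using fin by (auto simp: weight_ideal_def variable_def vertex_weight_single split: if_splits)
  qed
  ultimately have "C' = C" using C(1) unfolding minimal_vertex_cover_def by blast
  then show ?thesis using that[OF C(1)] by (auto simp: C'_def)
qed

text \<open>Every vertex of a minimal cover has a neighbour outside, so multiplying by variables outside
  the cover completes each factor in the cover to an edge.\<close>

lemma packs_outside_cover:
  assumes C: "minimal_vertex_cover V E C"
    and S: "1 \<in> S" "\<And>p q. p \<in> S \<Longrightarrow> q \<in> S \<Longrightarrow> p * q \<in> S" "\<And>x. x \<in> V - C \<Longrightarrow> variable x \<in> S"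
  shows "\<exists>u. (monomial u :: ('v, 'k::idom) mpoly) \<in> S \<and> Poly_Mapping.keys u \<subseteq> V \<and>
    packs E (vertex_weight C a) (a + u)"
proof (induction "vertex_weight C a" arbitrary: a)
  case 0
  then show ?case using S(1) by (intro exI[of _ 0]) (simp add: monomial_0 packs.zero)
next
  case (Suc w)
  have fin: "finite C" using C finite_vertex_cover by (simp add: minimal_vertex_cover_def)
  have "vertex_weight C a \<noteq> 0" using Suc.hyps(2) by simp
  then obtain x where x: "x \<in> Poly_Mapping.keys a" "x \<in> C"
    using fin by (auto simp: vertex_weight_eq_0_iff)
  obtain y where y: "{x, y} \<in> E" "y \<in> V - C"
    using minimal_vertex_cover_private_edge[OF C x(2)] .
  \<comment> \<open>Taking off one factor \<open>x\<close> lowers the weight by 1; after induction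
    on \<open>b\<close>, a further factor \<open>y\<close> completes \<open>x\<close> to an
    edge.\<close>
  define b where "b = a - Poly_Mapping.single x 1"
  have ab: "a = b + Poly_Mapping.single x 1"
    using x(1) unfolding b_def
    by (intro poly_mapping_eqI) (auto simp: lookup_add lookup_minus lookup_single when_def in_keys_iff)
  have wb: "w = vertex_weight C b"
    using Suc.hyps(2) x(2) fin by (simp add: ab vertex_weight_add vertex_weight_single)
  obtain u where u: "(monomial u :: ('v, 'k) mpoly) \<in> S" "Poly_Mapping.keys u \<subseteq> V" "packs E w (b + u)"
    using Suc.hyps(1)[OF wb] wb by blast
  have "packs E (Suc w) (a + (u + Poly_Mapping.single y 1))"
    using packs.step[OF u(3) y(1)] by (simp add: ab ac_simps)
  moreover have "(monomial (u + Poly_Mapping.single y 1) :: ('v, 'k) mpoly) \<in> S"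
    using S(2)[OF u(1) S(3)[OF y(2)]] by (simp add: monomial_add variable_def)
  ultimately show ?case
    using u(2) y(2) Suc.hyps(2) by (intro exI[of _ "u + Poly_Mapping.single y 1"]) (auto simp: keys_add_nat)
qed

text \<open>For the first inclusion the primes of minimal covers suffice, since multipliers outside
  them cancel. The second must treat every associated prime; there the variables outside a cover
  supply the multiplier.\<close>

theorem symbolic_power_edge_ideal:
  "symbolic_power (mpoly_ring V) (edge_ideal V E :: ('v, 'k::idom) mpoly set) t =
    {f \<in> polys V. \<forall>C. minimal_vertex_cover V E C \<longrightarrow> f \<in> weight_ideal V C t}"
proof (intro equalityI subsetI)
  let ?I = "edge_ideal V E :: ('v, 'k) mpoly set"
  fix f :: "('v, 'k) mpoly"
  assume f: "f \<in> symbolic_power (mpoly_ring V) ?I t"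
  have "f \<in> weight_ideal V C t" if C: "minimal_vertex_cover V E C" for C
  proof -
    have cov: "vertex_cover V E C" using C by (simp add: minimal_vertex_cover_def)
    obtain s where s: "s \<in> polys V - weight_ideal V C 1" "s * f \<in> ?I [^]\<^bsub>ideals_set (ring_on (polys V))\<^esub> t"
      using f weight_ideal_associated_prime[OF C, where 'k = 'k]
      unfolding mpoly_ring_eq symbolic_power_iff[OF cring_polys ideal_edge_ideal] by blast
    have "f \<in> polys V"
      using f unfolding mpoly_ring_eq symbolic_power_iff[OF cring_polys ideal_edge_ideal] by blast
    then show ?thesis
      using s edge_ideal_power_subset_weight_ideal[OF cov, of t, where 'k = 'k]
        weight_ideal_of_mult[of s C f t] by blast
  qed
  moreover have "f \<in> polys V"
    using f unfolding mpoly_ring_eq symbolic_power_iff[OF cring_polys ideal_edge_ideal] by blast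
  ultimately show "f \<in> {f \<in> polys V. \<forall>C. minimal_vertex_cover V E C \<longrightarrow> f \<in> weight_ideal V C t}"
    by blast
next
  let ?I = "edge_ideal V E :: ('v, 'k) mpoly set"
  let ?It = "?I [^]\<^bsub>ideals_set (ring_on (polys V))\<^esub> t"
  fix f :: "('v, 'k) mpoly"
  assume f: "f \<in> {f \<in> polys V. \<forall>C. minimal_vertex_cover V E C \<longrightarrow> f \<in> weight_ideal V C t}"
  have "\<exists>s \<in> polys V - P. s * f \<in> ?It" if P: "P \<in> associated_primes (ring_on (polys V)) ?I" for P
  proof -
    have prime: "primeideal P (ring_on (polys V))" using P by (simp add: associated_primes_def)
    obtain C where C: "minimal_vertex_cover V E C" "\<And>x. x \<in> V - C \<Longrightarrow> variable x \<notin> P"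
      using associated_prime_minimal_cover[OF P] by metis
    \<comment> \<open>The multiplier depends on the monomial; since the saturation is an ideal, one
      multiplier exists for all of \<open>f\<close>.\<close>
    have "f \<in> {f \<in> polys V. \<exists>s \<in> polys V - P. s * f \<in> ?It}"
    proof (rule poly_in_ideal[OF ideal_saturation[OF prime ideal_pow_is_ideal]])
      fix a assume a: "a \<in> Poly_Mapping.keys f"
      then have aV: "Poly_Mapping.keys a \<subseteq> V" and wa: "t \<le> vertex_weight C a"
        using f C(1) by (auto simp: polys_def weight_ideal_def)
      obtain u where u: "monomial u \<in> polys V - P" "Poly_Mapping.keys u \<subseteq> V"
        "packs E (vertex_weight C a) (a + u)"
        using packs_outside_cover[OF C(1), of "polys V - P" a] primeideal_ring_onD[OF prime] C(2)
        by (auto simp: variable_in_polys_iff)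
      have "monomial (u + a) \<in> ?It"
        using packs_imp_monomial_in_power[OF packs_antimono[OF u(3) wa], where 'k = 'k] aV u(2)
        by (simp add: keys_add_nat add.commute)
      then show "monomial a \<in> {f \<in> polys V. \<exists>s \<in> polys V - P. s * f \<in> ?It}"
        using u(1) aV by (auto simp: monomial_add monomial_in_polys_iff)
    qed (rule cring_polys ideal_edge_ideal)+
    then show ?thesis by simp
  qed
  then show "f \<in> symbolic_power (mpoly_ring V) ?I t"
    using f unfolding mpoly_ring_eq symbolic_power_iff[OF cring_polys ideal_edge_ideal]
    by (intro conjI ballI) simp_all
qed

end

section \<open>The symbolic powers of the odd cycle\<close>

lemma simple_graph_cycle:
  assumes "3 \<le> N"
  shows "simple_graph {1..N} (cycle_edges N)"
proof
  fix x y assume "{x, y} \<in> cycle_edges N"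
  then consider j where "1 \<le> j" "j < N" "{x, y} = {j, j + 1}" | "{x, y} = {N, 1}"
    unfolding cycle_edges_def by blast
  then show "x \<in> {1..N} \<and> y \<in> {1..N} \<and> x \<noteq> y"
    using assms by cases (auto simp: doubleton_eq_iff)
next
  fix e assume "e \<in> cycle_edges N"
  then consider j where "e = {j, j + 1}" | "e = {N, 1}"
    unfolding cycle_edges_def by blast
  then show "\<exists>x y. e = {x, y}" by (metis (no_types))
qed simp

theorem corollary4p5:
  fixes n t :: nat
    and V :: "nat set" and E :: "nat set set"
    and R :: "(nat, 'k::alg_closed_field) mpoly ring"
    and I :: "(nat, 'k) mpoly set"
  assumes "n \<ge> 1" and "t \<ge> 1"
    and "V = {1..2 * n + 1}" and "E = cycle_edges (2 * n + 1)"
    and "R = mpoly_ring V" and "I = edge_ideal V E"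
  shows "symbolic_power R I t = I [^]\<^bsub>ideals_set R\<^esub> t <+>\<^bsub>R\<^esub> Idl\<^bsub>R\<^esub> (D_set V E t)"
proof -
  interpret simple_graph V E
    unfolding assms(3,4) using assms(1) by (intro simple_graph_cycle) simp
  note R = assms(5)[unfolded mpoly_ring_eq]
  interpret R: cring R unfolding R by (rule cring_polys)
  let ?W = "\<lambda>C. weight_ideal V C t :: (nat, 'k) mpoly set"
  let ?D = "D_set V E t :: (nat, 'k) mpoly set"
  let ?S = "I [^]\<^bsub>ideals_set R\<^esub> t <+>\<^bsub>R\<^esub> Idl\<^bsub>R\<^esub> ?D"
  have D_carrier: "?D \<subseteq> carrier R" by (auto simp: R D_set_def monomial_in_polys_iff)
  have power: "ideal (I [^]\<^bsub>ideals_set R\<^esub> t) R"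
    unfolding R assms(6) by (intro ideal_pow_is_ideal cring_polys ideal_edge_ideal)
  have gen: "ideal (Idl\<^bsub>R\<^esub> ?D) R" by (rule R.genideal_ideal[OF D_carrier])
  have S: "ideal ?S (ring_on (polys V))" using R.add_ideals[OF power gen] by (simp add: R)
  have memS: "p \<in> ?S" if "p \<in> I [^]\<^bsub>ideals_set R\<^esub> t \<or> p \<in> ?D" for p
  proof -
    have zero: "0 \<in> I [^]\<^bsub>ideals_set R\<^esub> t" "0 \<in> Idl\<^bsub>R\<^esub> ?D"
      using power gen ideal_ring_onD(1) unfolding R by blast+
    from that show ?thesis
    proof
      assume "p \<in> I [^]\<^bsub>ideals_set R\<^esub> t"
      then show ?thesis
        using zero(2) unfolding set_add_def' by (intro UN_I[of p] UN_I[of 0]) (simp_all add: R)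
    next
      assume "p \<in> ?D"
      then have "p \<in> Idl\<^bsub>R\<^esub> ?D" using R.genideal_self[OF D_carrier] by blast
      then show ?thesis
        using zero(1) unfolding set_add_def' by (intro UN_I[of 0] UN_I[of p]) (simp_all add: R)
    qed
  qed
  have sym: "symbolic_power R I t =
      {f \<in> polys V. \<forall>C. minimal_vertex_cover V E C \<longrightarrow> f \<in> ?W C}"
    unfolding assms(5,6) by (rule symbolic_power_edge_ideal)
  show ?thesis
  proof
    show "?S \<subseteq> symbolic_power R I t"
    proof
      fix p assume "p \<in> ?S"
      then obtain g d where p: "p = g + d" "g \<in> I [^]\<^bsub>ideals_set R\<^esub> t" "d \<in> Idl\<^bsub>R\<^esub> ?D"
        unfolding set_add_def' by (auto simp: R)
      have "p \<in> ?W C" if C: "minimal_vertex_cover V E C" for C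
      proof -
        have "vertex_cover V E C" using C by (simp add: minimal_vertex_cover_def)
        then have "g \<in> ?W C"
          using p(2) edge_ideal_power_subset_weight_ideal unfolding R assms(6) by blast
        \<comment> \<open>The generators in \<open>?D\<close> satisfy the weight bound by
          definition, and the bound defines an ideal.\<close>
        moreover have "?D \<subseteq> ?W C"
          using C by (auto simp: D_set_def weight_ideal_def monomial_in_polys_iff)
        then have "d \<in> ?W C"
          using R.genideal_minimal[of "?W C" ?D] ideal_weight_ideal p(3) unfolding R by blast
        ultimately show ?thesis unfolding p(1) by (rule weight_ideal_add)
      qed
      moreover have "p \<in> polys V" using ideal_ring_onD(4)[OF S] \<open>p \<in> ?S\<close> by blast
      ultimately show "p \<in> symbolic_power R I t" unfolding sym by blast
    qed
  next
    show "symbolic_power R I t \<subseteq> ?S"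
    proof
      fix p assume p: "p \<in> symbolic_power R I t"
      show "p \<in> ?S"
      proof (rule poly_in_ideal[OF S])
        fix a assume a: "a \<in> Poly_Mapping.keys p"
        then have aV: "Poly_Mapping.keys a \<subseteq> V" using p by (auto simp: sym polys_def)
        have wa: "t \<le> vertex_weight C a" if "minimal_vertex_cover V E C" for C
          using p a that by (auto simp: sym weight_ideal_def)
        have deg: "vertex_weight V a = monomial_degree a"
          using aV finite_vertices by (intro vertex_weight_superset)
        show "monomial a \<in> ?S"
        \<comment> \<open>The degree decides the summand: below \<open>2 * t\<close> the monomial is
          a generator in \<open>?D\<close>, otherwise it is divisible by a product of
          \<open>t\<close> edges.\<close>
        proof (cases "monomial_degree a < 2 * t")
          case True
          then show ?thesis using aV wa by (intro memS) (auto simp: D_set_def)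
        next
          case False
          \<comment> \<open>Packing asks for the bound on all covers, so it is carried over from a
            minimal cover inside \<open>C\<close>.\<close>
          have "t \<le> vertex_weight C a" if C: "vertex_cover V E C" for C
          proof -
            obtain C' where "C' \<subseteq> C" "minimal_vertex_cover V E C'"
              using minimal_vertex_cover_exists[OF finite_vertices C] by metis
            then show ?thesis
              using wa vertex_weight_mono[OF finite_vertex_cover[OF C]] order.trans by blast
          qed
          then have "packs E t a"
            using False deg assms(1) unfolding assms(3,4) by (intro packs_odd_cycle) auto
          then show ?thesis
            using packs_imp_monomial_in_power[OF _ aV, of t, where 'k = 'k] by (intro memS) (simp add: R assms(6))
        qed
      qed
    qed
  qed
qed

end
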